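(* Let $\mathcal{X}=\mathbb{R}^{d'}$, $\mathcal{Y}=\mathbb{R}^d$ with $d,d'\ge1$, and let $p>1$. For $\nu\in\mathcal{P}_p(\mathcal{Y})$ and a measurable map $\phi:\mathcal{X}\to\mathcal{Y}$, consider the transport map noise $\rho_x=\delta_{\phi(x)}$, so that $\nu_\sigma=\phi\#\sigma$; let $\mathscr{A}$ be the set of minimizers of $\sigma\mapsto W_p^p(\nu_\sigma,\nu)$ over $\mathcal{P}(\mathcal{X})$, and consider the conditions (CTY) $x\mapsto\rho_x$ is continuous in the narrow topology; (CRC) $x\mapsto M_p(\rho_x)$ has totally bounded sublevel sets; (INJ) $\sigma\mapsto\nu_\sigma$ is injective on $\mathscr{A}$; (feasibility) $\inf_{\sigma\in\mathcal{P}(\mathcal{X})}W_p^p(\nu_\sigma,\nu)<+\infty$. Then: (i) There exist $\nu\in\mathcal{P}_p(\mathcal{Y})$, not satisfying $\nu\ll\mathcal{L}^d$, and transport map noise $\rho$ such that (INJ) and feasibility hold, and for which minimizers are not unique (i.e. $\mathscr{A}$ has more than one element). (ii) Suppose $d\ge2$. Then there exist $\nu\in\mathcal{P}_p(\mathcal{Y})$, not satisfying $\nu\ll\mathcal{L}^d$, and transport map noise $\rho$ such that (CTY), (CRC), (INJ) and feasibility hold, and for which minimizers are not unique.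
   Context: $\mathcal{X}=\mathbb{R}^{d'}$ carries the Euclidean metric. $\mathcal{P}(\cdot)$ denotes Borel probability measures; $\mathcal{L}^d$ is Lebesgue measure on $\mathbb{R}^d$; $\delta_a$ is the Dirac mass at $a$. $M_p(\mu)=\int|y|^p\,d\mu(y)\in[0,\infty]$ and $\mathcal{P}_p(\mathcal{Y})=\{\mu\in\mathcal{P}(\mathcal{Y}):M_p(\mu)<\infty\}$. $\phi\#\sigma$ is the pushforward of $\sigma$ by $\phi$. $W_p^p(\mu_1,\mu_2)=\inf_\Gamma\int|y'-y|^p\,d\Gamma(y',y)\in[0,\infty]$, the infimum over couplings of $\mu_1,\mu_2$. Narrow topology: convergence against bounded continuous functions. *)

theory Defs
  imports "HOL-Probability.Probability"
begin

definition borel_probs :: "'a::topological_space measure set" where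
  "borel_probs = {\<mu>. prob_space \<mu> \<and> sets \<mu> = sets borel}"

text \<open>The coarsest topology on the Borel probability measures for which integration
  of every bounded continuous real function is continuous.\<close>

definition narrow_topology :: "'a::topological_space measure topology" where
  "narrow_topology = topology_generated_by
     {{\<mu> \<in> borel_probs. (\<integral>y. f y \<partial>\<mu>) \<in> U} | (f :: 'a \<Rightarrow> real) U.
        continuous_on UNIV f \<and> bounded (range f) \<and> open U}"

lemma topspace_narrow: "topspace narrow_topology = (borel_probs :: 'a::topological_space measure set)"
proof -
  have "borel_probs \<in> {{\<mu> \<in> borel_probs. (\<integral>y. f y \<partial>\<mu>) \<in> U} | (f :: 'a \<Rightarrow> real) U.
        continuous_on UNIV f \<and> bounded (range f) \<and> open U}"
    by (rule CollectI, rule exI[of _ "\<lambda>_. 0"], rule exI[of _ UNIV]) auto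
  then show ?thesis
    unfolding narrow_topology_def topology_generated_by_topspace by auto
qed

lemma limitin_narrow_iff:
  fixes \<mu> :: "'a::topological_space measure"
  shows "limitin narrow_topology m \<mu> F \<longleftrightarrow>
    \<mu> \<in> borel_probs \<and> eventually (\<lambda>i. m i \<in> borel_probs) F \<and>
    (\<forall>f :: 'a \<Rightarrow> real. continuous_on UNIV f \<longrightarrow> bounded (range f) \<longrightarrow>
       ((\<lambda>i. \<integral>y. f y \<partial>m i) \<longlongrightarrow> (\<integral>y. f y \<partial>\<mu>)) F)"
    (is "?L \<longleftrightarrow> ?R")
proof
  assume L: ?L
  then have \<mu>: "\<mu> \<in> borel_probs"
    by (simp add: limitin_def topspace_narrow)
  have "openin narrow_topology (borel_probs :: 'a measure set)"
    by (metis openin_topspace topspace_narrow)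
  then have ev: "eventually (\<lambda>i. m i \<in> borel_probs) F"
    using L \<mu> by (auto simp: limitin_def)
  have "((\<lambda>i. \<integral>y. f y \<partial>m i) \<longlongrightarrow> (\<integral>y. f y \<partial>\<mu>)) F"
    if f: "continuous_on UNIV f" "bounded (range f)" for f :: "'a \<Rightarrow> real"
  proof (rule topological_tendstoI)
    fix U :: "real set" assume U: "open U" "(\<integral>y. f y \<partial>\<mu>) \<in> U"
    have "openin narrow_topology {\<mu> \<in> borel_probs. (\<integral>y. f y \<partial>\<mu>) \<in> U}"
      unfolding narrow_topology_def
      by (rule topology_generated_by_Basis) (use f U in blast)
    then show "eventually (\<lambda>i. (\<integral>y. f y \<partial>m i) \<in> U) F"
      using L \<mu> U(2) unfolding limitin_def by (fastforce elim: eventually_mono)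
  qed
  with \<mu> ev show ?R by blast
next
  assume R: ?R
  have "eventually (\<lambda>i. m i \<in> V) F" if "openin narrow_topology V" "\<mu> \<in> V" for V
  proof -
    from that(1) have "generate_topology_on
      {{\<mu> \<in> borel_probs. (\<integral>y. f y \<partial>\<mu>) \<in> U} | (f :: 'a \<Rightarrow> real) U.
        continuous_on UNIV f \<and> bounded (range f) \<and> open U} V"
      unfolding narrow_topology_def by (rule openin_topology_generated_by)
    then show ?thesis using that(2)
    proof induction
      case Empty then show ?case by simp
    next
      case (Int a b) then show ?case by (auto intro: eventually_conj)
    next
      case (UN K)
      then obtain k where k: "k \<in> K" "\<mu> \<in> k" by blast
      then have "eventually (\<lambda>i. m i \<in> k) F" using UN.IH by blast
      then show ?case by (rule eventually_mono) (use k in blast)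
    next
      case (Basis s)
      then obtain f :: "'a \<Rightarrow> real" and U where s: "s = {\<mu> \<in> borel_probs. (\<integral>y. f y \<partial>\<mu>) \<in> U}"
        and f: "continuous_on UNIV f" "bounded (range f)" and U: "open U" by blast
      then have "eventually (\<lambda>i. (\<integral>y. f y \<partial>m i) \<in> U) F"
        using R Basis.prems by (auto intro: topological_tendstoD)
      with R show ?case unfolding s by (auto elim: eventually_elim2)
    qed
  qed
  with R show ?L by (auto simp: limitin_def topspace_narrow)
qed

definition moment :: "real \<Rightarrow> 'a::euclidean_space measure \<Rightarrow> ennreal" where
  "moment p \<mu> = (\<integral>\<^sup>+y. ennreal (norm y powr p) \<partial>\<mu>)"

definition finite_moment_probs :: "real \<Rightarrow> 'a::euclidean_space measure set" where
  "finite_moment_probs p = {\<mu> \<in> borel_probs. moment p \<mu> < \<infinity>}"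

definition couplings ::
  "'a::euclidean_space measure \<Rightarrow> 'a measure \<Rightarrow> ('a \<times> 'a) measure set" where
  "couplings \<mu>1 \<mu>2 = {\<Gamma> \<in> borel_probs. distr \<Gamma> borel fst = \<mu>1 \<and> distr \<Gamma> borel snd = \<mu>2}"

text \<open>The \<open>p\<close>-th power of the Wasserstein distance, with values in \<open>[0, \<infinity>]\<close>.\<close>

definition wasserstein_pow ::
  "real \<Rightarrow> 'a::euclidean_space measure \<Rightarrow> 'a measure \<Rightarrow> ennreal" where
  "wasserstein_pow p \<mu>1 \<mu>2 =
     (INF \<Gamma> \<in> couplings \<mu>1 \<mu>2. \<integral>\<^sup>+z. ennreal (norm (fst z - snd z) powr p) \<partial>\<Gamma>)"

text \<open>A noise \<open>\<rho>\<close> assigns to each \<open>x\<close> a probability measure; \<open>\<nu>\<^sub>\<sigma>\<close> is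
  the mixture of the \<open>\<rho> x\<close> under \<open>\<sigma>\<close>, that is, the Giry bind.\<close>

definition mixture ::
  "('a::euclidean_space \<Rightarrow> 'b::euclidean_space measure) \<Rightarrow> 'a measure \<Rightarrow> 'b measure" where
  "mixture \<rho> \<sigma> = \<sigma> \<bind> \<rho>"

definition transport_map_noise ::
  "('a::euclidean_space \<Rightarrow> 'b::euclidean_space) \<Rightarrow> 'a \<Rightarrow> 'b measure" where
  "transport_map_noise \<phi> x = return borel (\<phi> x)"

lemma mixture_transport_map_noise:
  assumes "\<sigma> \<in> borel_probs" "\<phi> \<in> borel_measurable borel"
  shows "mixture (transport_map_noise \<phi>) \<sigma> = distr \<sigma> borel \<phi>"
proof -
  have "space \<sigma> \<noteq> {}"
    using assms(1) by (simp add: borel_probs_def prob_space.not_empty)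
  moreover have "\<phi> \<in> borel_measurable \<sigma>"
    using assms measurable_cong_sets by (auto simp: borel_probs_def)
  ultimately show ?thesis
    unfolding mixture_def transport_map_noise_def[abs_def] by (rule bind_return_distr')
qed

definition minimizers ::
  "real \<Rightarrow> ('a::euclidean_space \<Rightarrow> 'b::euclidean_space measure) \<Rightarrow> 'b measure \<Rightarrow> 'a measure set" where
  "minimizers p \<rho> \<nu> = {\<sigma> \<in> borel_probs. \<forall>\<tau> \<in> borel_probs.
     wasserstein_pow p (mixture \<rho> \<sigma>) \<nu> \<le> wasserstein_pow p (mixture \<rho> \<tau>) \<nu>}"

definition CTY :: "('a::euclidean_space \<Rightarrow> 'b::euclidean_space measure) \<Rightarrow> bool" where
  "CTY \<rho> \<longleftrightarrow> continuous_map euclidean narrow_topology \<rho>"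

text \<open>Only finite levels count: the sublevel set at level \<open>\<infinity>\<close> is the whole space.\<close>

definition CRC :: "real \<Rightarrow> ('a::euclidean_space \<Rightarrow> 'b::euclidean_space measure) \<Rightarrow> bool" where
  "CRC p \<rho> \<longleftrightarrow> (\<forall>c < \<infinity>. totally_bounded {x. moment p (\<rho> x) \<le> c})"

definition INJ ::
  "real \<Rightarrow> ('a::euclidean_space \<Rightarrow> 'b::euclidean_space measure) \<Rightarrow> 'b measure \<Rightarrow> bool" where
  "INJ p \<rho> \<nu> \<longleftrightarrow> inj_on (mixture \<rho>) (minimizers p \<rho> \<nu>)"

definition feasible ::
  "real \<Rightarrow> ('a::euclidean_space \<Rightarrow> 'b::euclidean_space measure) \<Rightarrow> 'b measure \<Rightarrow> bool" where
  "feasible p \<rho> \<nu> \<longleftrightarrow> (INF \<sigma> \<in> borel_probs. wasserstein_pow p (mixture \<rho> \<sigma>) \<nu>) < \<infinity>"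

end

theory Submission
  imports Defs
begin

text \<open>Take \<open>\<nu> = \<delta>\<^sub>0\<close>. The only coupling of \<open>\<phi>#\<sigma>\<close> with a Dirac mass is the product, so the
  functional is the linear one \<open>\<sigma> \<mapsto> \<integral> \<bar>\<phi>\<bar>\<^sup>p d\<sigma>\<close>, and its minimizers are the measures
  concentrated where \<open>\<bar>\<phi>\<bar>\<close> is minimal. If \<open>\<phi>\<close> attains its minimal norm at exactly two points,
  with distinct images there, then the minimizers form a segment on which \<open>\<sigma> \<mapsto> \<phi>#\<sigma>\<close> is injective.
  A discontinuous such \<open>\<phi>\<close> exists in any dimension; in dimension at least two there is a
  continuous proper one.\<close>

section \<open>Transport cost to a Dirac measure\<close>

lemma return_in_borel_probs [simp]:
  "return borel a \<in> borel_probs"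
  by (simp add: borel_probs_def prob_space_return)

lemma distr_in_borel_probs:
  assumes "\<mu> \<in> borel_probs" "f \<in> borel_measurable borel"
  shows "distr \<mu> borel f \<in> borel_probs"
proof -
  have "f \<in> borel_measurable \<mu>"
    using assms measurable_cong_sets by (auto simp: borel_probs_def)
  then show ?thesis
    using assms by (simp add: borel_probs_def prob_space.prob_space_distr)
qed

text \<open>A Dirac second marginal forces \<open>snd z = a\<close> almost surely, so the cost only
  sees the first marginal and is the same for every coupling.\<close>

lemma coupling_return_cost:
  fixes \<mu> :: "'a::euclidean_space measure"
  assumes "\<Gamma> \<in> couplings \<mu> (return borel a)"
  shows "(\<integral>\<^sup>+z. ennreal (norm (fst z - snd z) powr p) \<partial>\<Gamma>) = (\<integral>\<^sup>+y. ennreal (norm (y - a) powr p) \<partial>\<mu>)"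
proof -
  have sets: "sets \<Gamma> = sets borel"
    and fst: "distr \<Gamma> borel fst = \<mu>" and snd: "distr \<Gamma> borel snd = return borel a"
    using assms by (auto simp: couplings_def borel_probs_def)
  have m: "fst \<in> \<Gamma> \<rightarrow>\<^sub>M borel" "snd \<in> \<Gamma> \<rightarrow>\<^sub>M borel"
    unfolding measurable_cong_sets[OF sets refl]
    by (auto intro!: borel_measurable_continuous_onI continuous_intros)
  have "AE y in distr \<Gamma> borel snd. y = a"
    unfolding snd by (subst AE_return) auto
  then have "AE z in \<Gamma>. snd z = a"
    by (subst (asm) AE_distr_iff) (use m in auto)
  then have "(\<integral>\<^sup>+z. ennreal (norm (fst z - snd z) powr p) \<partial>\<Gamma>) = (\<integral>\<^sup>+z. ennreal (norm (fst z - a) powr p) \<partial>\<Gamma>)"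
    by (intro nn_integral_cong_AE) auto
  also have "\<dots> = (\<integral>\<^sup>+y. ennreal (norm (y - a) powr p) \<partial>distr \<Gamma> borel fst)"
    by (subst nn_integral_distr) (use m in auto)
  finally show ?thesis unfolding fst .
qed

lemma wasserstein_pow_return:
  fixes \<mu> :: "'a::euclidean_space measure"
  assumes "\<mu> \<in> borel_probs"
  shows "wasserstein_pow p \<mu> (return borel a) = (\<integral>\<^sup>+y. ennreal (norm (y - a) powr p) \<partial>\<mu>)"
proof -
  interpret prob_space \<mu> using assms by (simp add: borel_probs_def)
  have sets: "sets \<mu> = sets borel" using assms by (simp add: borel_probs_def)
  have pair: "(\<lambda>y. (y, a)) \<in> borel_measurable borel"
    by (auto intro!: borel_measurable_continuous_onI continuous_intros)
  have meas: "f \<in> \<mu> \<rightarrow>\<^sub>M borel" if "f \<in> borel_measurable borel" for f :: "'a \<Rightarrow> 'b::topological_space"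
    using that measurable_cong_sets[OF sets refl] by auto
  have proj: "fst \<in> borel_measurable (borel :: ('a \<times> 'a) measure)"
    "snd \<in> borel_measurable (borel :: ('a \<times> 'a) measure)"
    by (auto intro!: borel_measurable_continuous_onI continuous_intros)
  \<comment> \<open>All couplings cost the same, so one witness settles the infimum; over an empty
    set it would be infinite.\<close>
  have "distr \<mu> borel (\<lambda>y. (y, a)) \<in> couplings \<mu> (return borel a)"
    unfolding couplings_def
    by (auto simp: distr_in_borel_probs[OF assms pair] distr_distr proj
          meas[OF pair] o_def distr_id2 sets intro!: distr_const)
  then have "couplings \<mu> (return borel a) \<noteq> {}" by blast
  then show ?thesis
    unfolding wasserstein_pow_def by (simp add: coupling_return_cost)
qed

lemma wasserstein_pow_transport_map_noise:
  fixes \<phi> :: "'a::euclidean_space \<Rightarrow> 'b::euclidean_space"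
  assumes "\<sigma> \<in> borel_probs" "\<phi> \<in> borel_measurable borel"
  shows "wasserstein_pow p (mixture (transport_map_noise \<phi>) \<sigma>) (return borel a) =
    (\<integral>\<^sup>+x. ennreal (norm (\<phi> x - a) powr p) \<partial>\<sigma>)"
proof -
  have "\<phi> \<in> borel_measurable \<sigma>"
    using assms measurable_cong_sets by (auto simp: borel_probs_def)
  then show ?thesis
    using assms
    by (simp add: mixture_transport_map_noise wasserstein_pow_return distr_in_borel_probs nn_integral_distr)
qed

section \<open>Minimizers for a Dirac target\<close>

text \<open>The nonnegative excess \<open>f x - c\<close> has integral zero and so vanishes almost
  everywhere. Total mass one turns the constant into \<open>c\<close>, and finiteness of
  \<open>c\<close> permits cancelling it in \<open>ennreal\<close>, even before the integral of
  \<open>f\<close> is known to be finite.\<close>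

lemma (in prob_space) AE_eq_of_nn_integral_le:
  fixes f :: "'a \<Rightarrow> real"
  assumes "f \<in> borel_measurable M" "0 \<le> c" "\<And>x. c \<le> f x"
    and "(\<integral>\<^sup>+x. ennreal (f x) \<partial>M) \<le> ennreal c"
  shows "AE x in M. f x = c"
proof -
  have "(\<integral>\<^sup>+x. ennreal (f x) \<partial>M) = (\<integral>\<^sup>+x. ennreal c + ennreal (f x - c) \<partial>M)"
    using assms(2,3) by (intro nn_integral_cong) (simp flip: ennreal_plus)
  also have "\<dots> = ennreal c + (\<integral>\<^sup>+x. ennreal (f x - c) \<partial>M)"
    using assms(1) by (simp add: nn_integral_add emeasure_space_1)
  finally have "ennreal c + (\<integral>\<^sup>+x. ennreal (f x - c) \<partial>M) \<le> ennreal c + 0"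
    using assms(4) by simp
  then have "(\<integral>\<^sup>+x. ennreal (f x - c) \<partial>M) = 0"
    by (metis add_left_mono ennreal_add_left_cancel_le ennreal_neq_top infinity_ennreal_def le_zero_eq)
  then have "AE x in M. ennreal (f x - c) = 0"
    using assms(1) by (subst (asm) nn_integral_0_iff_AE) auto
  then show ?thesis
    using assms(3) by (auto simp: ennreal_eq_0_iff intro: antisym)
qed

text \<open>The cost is the integral of a function bounded below by its value \<open>c\<close> at
  \<open>x0\<close>. The Dirac mass at \<open>x0\<close> attains \<open>c\<close>, so minimality
  means cost at most \<open>c\<close>, which is the equality case of the preceding lemma.\<close>

lemma minimizers_transport_map_noise_return:
  fixes \<phi> :: "'a::euclidean_space \<Rightarrow> 'b::euclidean_space"
  assumes "p > 0" and meas: "\<phi> \<in> borel_measurable borel"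
    and x0: "\<And>x. norm (\<phi> x0 - a) \<le> norm (\<phi> x - a)"
  shows "minimizers p (transport_map_noise \<phi>) (return borel a) =
    {\<sigma> \<in> borel_probs. AE x in \<sigma>. norm (\<phi> x - a) = norm (\<phi> x0 - a)}"
proof -
  define c where "c = norm (\<phi> x0 - a) powr p"
  define W where "W \<sigma> = wasserstein_pow p (mixture (transport_map_noise \<phi>) \<sigma>) (return borel a)" for \<sigma>
  have W: "W \<sigma> = (\<integral>\<^sup>+x. ennreal (norm (\<phi> x - a) powr p) \<partial>\<sigma>)" if "\<sigma> \<in> borel_probs" for \<sigma>
    unfolding W_def using that meas by (rule wasserstein_pow_transport_map_noise)
  have c_le: "c \<le> norm (\<phi> x - a) powr p" for x
    unfolding c_def using x0 \<open>p > 0\<close> by (intro powr_mono2) auto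
  have lower: "ennreal c \<le> W \<sigma>" if "\<sigma> \<in> borel_probs" for \<sigma>
  proof -
    interpret prob_space \<sigma> using that by (simp add: borel_probs_def)
    have "ennreal c = (\<integral>\<^sup>+x. ennreal c \<partial>\<sigma>)" by (simp add: emeasure_space_1)
    also have "\<dots> \<le> W \<sigma>"
      unfolding W[OF that] using c_le by (intro nn_integral_mono) (simp add: ennreal_leI)
    finally show ?thesis .
  qed
  have attained: "W \<sigma> = ennreal c"
    if "\<sigma> \<in> borel_probs" "AE x in \<sigma>. norm (\<phi> x - a) = norm (\<phi> x0 - a)" for \<sigma>
  proof -
    interpret prob_space \<sigma> using that by (simp add: borel_probs_def)
    have "W \<sigma> = (\<integral>\<^sup>+x. ennreal c \<partial>\<sigma>)"
      unfolding W[OF that(1)] using that(2)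
      by (intro nn_integral_cong_AE) (auto simp: c_def)
    then show ?thesis by (simp add: emeasure_space_1)
  qed
  have dirac: "W (return borel x0) = ennreal c"
    using meas by (intro attained) (auto simp: AE_return)
  have concentrated: "AE x in \<sigma>. norm (\<phi> x - a) = norm (\<phi> x0 - a)"
    if \<sigma>: "\<sigma> \<in> borel_probs" "W \<sigma> \<le> ennreal c" for \<sigma>
  proof -
    interpret prob_space \<sigma> using \<sigma> by (simp add: borel_probs_def)
    have [measurable]: "\<phi> \<in> borel_measurable \<sigma>"
      using \<sigma>(1) meas measurable_cong_sets by (auto simp: borel_probs_def)
    have "AE x in \<sigma>. norm (\<phi> x - a) powr p = c"
      using \<sigma>(2) c_le unfolding W[OF \<sigma>(1)]
      by (intro AE_eq_of_nn_integral_le) (auto simp: c_def)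
    \<comment> \<open>For \<open>p > 0\<close> the power is strictly increasing on nonnegative
      reals, so equal powers give equal norms.\<close>
    then show ?thesis
      unfolding c_def
      by eventually_elim (use \<open>p > 0\<close> in \<open>metis norm_ge_zero powr_less_mono2 linorder_neq_iff\<close>)
  qed
  show ?thesis
    unfolding minimizers_def W_def[symmetric]
  proof (intro Collect_cong conj_cong refl iffI)
    fix \<sigma> :: "'a measure" assume \<sigma>: "\<sigma> \<in> borel_probs"
    show "AE x in \<sigma>. norm (\<phi> x - a) = norm (\<phi> x0 - a)" if "\<forall>\<tau>\<in>borel_probs. W \<sigma> \<le> W \<tau>"
      using concentrated[OF \<sigma>] bspec[OF that, of "return borel x0"] dirac by simp
    show "\<forall>\<tau>\<in>borel_probs. W \<sigma> \<le> W \<tau>" if "AE x in \<sigma>. norm (\<phi> x - a) = norm (\<phi> x0 - a)"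
      using attained[OF \<sigma> that] lower by simp
  qed
qed

section \<open>Injectivity of the pushforward\<close>

text \<open>Since \<phi> is injective on \<open>A\<close>, pulling back the image of
  \<open>B \<inter> A\<close> returns \<open>B\<close> up to a \<sigma>-null set, so \<sigma> can be
  read off from its pushforward.\<close>

lemma distr_inj_on_finite_support:
  fixes \<phi> :: "'a::euclidean_space \<Rightarrow> 'b::euclidean_space"
  assumes "finite A" "inj_on \<phi> A" "\<phi> \<in> borel_measurable borel"
  shows "inj_on (\<lambda>\<sigma>. distr \<sigma> borel \<phi>) {\<sigma> \<in> borel_probs. AE x in \<sigma>. x \<in> A}"
proof -
  have recover: "emeasure \<sigma> B = emeasure (distr \<sigma> borel \<phi>) (\<phi> ` (B \<inter> A))"
    if \<sigma>: "\<sigma> \<in> borel_probs" "AE x in \<sigma>. x \<in> A" and B: "B \<in> sets borel" for \<sigma> B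
  proof -
    have sets: "sets \<sigma> = sets borel" using \<sigma> by (simp add: borel_probs_def)
    have space: "space \<sigma> = UNIV" using sets_eq_imp_space_eq[OF sets] by simp
    have \<phi>: "\<phi> \<in> borel_measurable \<sigma>"
      using assms(3) measurable_cong_sets[OF sets refl] by blast
    \<comment> \<open>Finiteness of \<open>A\<close> makes the image closed; the image of a general
      Borel set need not be Borel.\<close>
    have fin: "\<phi> ` (B \<inter> A) \<in> sets borel"
      using assms(1) by (intro borel_closed finite_imp_closed) auto
    have "emeasure (distr \<sigma> borel \<phi>) (\<phi> ` (B \<inter> A)) = emeasure \<sigma> (\<phi> -` \<phi> ` (B \<inter> A))"
      using \<phi> fin by (simp add: emeasure_distr space)
    also have "\<dots> = emeasure \<sigma> B"
    proof (rule emeasure_eq_AE)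
      show "AE x in \<sigma>. x \<in> \<phi> -` \<phi> ` (B \<inter> A) \<longleftrightarrow> x \<in> B"
        using \<sigma>(2) by eventually_elim (use assms(2) in \<open>auto dest: inj_onD\<close>)
      show "\<phi> -` \<phi> ` (B \<inter> A) \<in> sets \<sigma>"
        using measurable_sets[OF \<phi> fin] by (simp add: space)
      show "B \<in> sets \<sigma>" using B sets by simp
    qed
    finally show ?thesis ..
  qed
  show ?thesis
  proof (rule inj_onI)
    fix \<sigma> \<tau>
    assume \<sigma>: "\<sigma> \<in> {\<sigma> \<in> borel_probs. AE x in \<sigma>. x \<in> A}"
      and \<tau>: "\<tau> \<in> {\<sigma> \<in> borel_probs. AE x in \<sigma>. x \<in> A}"
      and eq: "distr \<sigma> borel \<phi> = distr \<tau> borel \<phi>"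
    show "\<sigma> = \<tau>"
    proof (rule measure_eqI)
      show "sets \<sigma> = sets \<tau>" using \<sigma> \<tau> by (simp add: borel_probs_def)
      fix B assume "B \<in> sets \<sigma>"
      then have B: "B \<in> sets borel" using \<sigma> by (simp add: borel_probs_def)
      show "emeasure \<sigma> B = emeasure \<tau> B"
        using recover[of \<sigma> B] recover[of \<tau> B] \<sigma> \<tau> B eq by auto
    qed
  qed
qed

lemma return_neq_return:
  fixes x y :: "'a::t1_space"
  assumes "x \<noteq> y"
  shows "return borel x \<noteq> return borel y"
proof
  assume "return borel x = return borel y"
  then have "emeasure (return borel x) {x} = emeasure (return borel y) {x}" by simp
  with assms show False by simp
qed

lemma return_in_finite_moment_probs:
  "return borel a \<in> finite_moment_probs p"
  by (simp add: finite_moment_probs_def moment_def nn_integral_return)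

text \<open>The dimension of a Euclidean space is positive, so a point is Lebesgue null, yet it
  carries the whole Dirac mass.\<close>

lemma not_absolutely_continuous_return:
  "\<not> absolutely_continuous lborel (return borel (a :: 'a::euclidean_space))"
proof
  assume "absolutely_continuous lborel (return borel a)"
  moreover have "{a} \<in> null_sets lborel" by (simp add: null_sets_def)
  ultimately have "{a} \<in> null_sets (return borel a)"
    unfolding absolutely_continuous_def by blast
  then show False by (simp add: null_sets_def)
qed

section \<open>Criterion for non-unique minimizers\<close>

text \<open>Common core of both examples: the minimizers are exactly the measures carried by
  \<open>{x0, x1}\<close>. Distinct images make the pushforward injective there, while the Dirac
  masses at the two points are different minimizers.\<close>

lemma transport_map_noise_two_nearest_points:
  fixes \<phi> :: "'a::euclidean_space \<Rightarrow> 'b::euclidean_space"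
  assumes "p > 0" and meas: "\<phi> \<in> borel_measurable borel"
    and neq: "\<phi> x0 \<noteq> \<phi> x1" and eq: "norm (\<phi> x1 - a) = norm (\<phi> x0 - a)"
    and far: "\<And>x. x \<noteq> x0 \<Longrightarrow> x \<noteq> x1 \<Longrightarrow> norm (\<phi> x0 - a) < norm (\<phi> x - a)"
  shows "INJ p (transport_map_noise \<phi>) (return borel a)"
    and "feasible p (transport_map_noise \<phi>) (return borel a)"
    and "\<exists>\<sigma> \<in> minimizers p (transport_map_noise \<phi>) (return borel a).
         \<exists>\<tau> \<in> minimizers p (transport_map_noise \<phi>) (return borel a). \<sigma> \<noteq> \<tau>"
proof -
  have "norm (\<phi> x0 - a) \<le> norm (\<phi> x - a)" for x
    using far[of x] eq by (cases "x = x0 \<or> x = x1") auto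
  then have minimizers: "minimizers p (transport_map_noise \<phi>) (return borel a) =
      {\<sigma> \<in> borel_probs. AE x in \<sigma>. norm (\<phi> x - a) = norm (\<phi> x0 - a)}"
    by (rule minimizers_transport_map_noise_return[OF assms(1) meas])
  also have "\<dots> = {\<sigma> \<in> borel_probs. AE x in \<sigma>. x \<in> {x0, x1}}"
  proof -
    have "norm (\<phi> x - a) = norm (\<phi> x0 - a) \<longleftrightarrow> x \<in> {x0, x1}" for x
      using far[of x] eq by fastforce
    then show ?thesis by simp
  qed
  finally have minimizers': "minimizers p (transport_map_noise \<phi>) (return borel a) =
    {\<sigma> \<in> borel_probs. AE x in \<sigma>. x \<in> {x0, x1}}" .
  have "inj_on (\<lambda>\<sigma>. distr \<sigma> borel \<phi>) {\<sigma> \<in> borel_probs. AE x in \<sigma>. x \<in> {x0, x1}}"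
    using neq meas by (intro distr_inj_on_finite_support) auto
  then show "INJ p (transport_map_noise \<phi>) (return borel a)"
    unfolding INJ_def minimizers'
    \<comment> \<open>The mixture is known to be the pushforward only on \<open>borel_probs\<close>,
      hence a congruence on the minimizers instead of a global rewrite.\<close>
    by (rule inj_on_cong[THEN iffD1, rotated]) (simp add: mixture_transport_map_noise meas)
  have "wasserstein_pow p (mixture (transport_map_noise \<phi>) (return borel x0)) (return borel a) < \<infinity>"
    using meas by (simp add: wasserstein_pow_transport_map_noise nn_integral_return)
  then show "feasible p (transport_map_noise \<phi>) (return borel a)"
    unfolding feasible_def by (meson INF_lower le_less_trans return_in_borel_probs)
  have "return borel x0 \<in> minimizers p (transport_map_noise \<phi>) (return borel a)"
    "return borel x1 \<in> minimizers p (transport_map_noise \<phi>) (return borel a)"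
    unfolding minimizers using meas eq by (auto simp: AE_return)
  moreover have "return borel x0 \<noteq> return borel x1"
    using neq return_neq_return by metis
  ultimately show "\<exists>\<sigma> \<in> minimizers p (transport_map_noise \<phi>) (return borel a).
         \<exists>\<tau> \<in> minimizers p (transport_map_noise \<phi>) (return borel a). \<sigma> \<noteq> \<tau>"
    by blast
qed

section \<open>Continuity and compactness conditions\<close>

text \<open>Integrating a test function \<open>f\<close> against the noise at \<open>x\<close> gives
  \<open>f (\<phi> x)\<close>, so narrow convergence reduces to continuity of a composition.\<close>

lemma CTY_transport_map_noise:
  fixes \<phi> :: "'a::euclidean_space \<Rightarrow> 'b::euclidean_space"
  assumes "continuous_on UNIV \<phi>"
  shows "CTY (transport_map_noise \<phi>)"
proof -
  have "limitin narrow_topology (transport_map_noise \<phi>) (transport_map_noise \<phi> x) (at x)" for x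
    unfolding limitin_narrow_iff transport_map_noise_def
  proof (intro conjI allI impI)
    fix f :: "'b \<Rightarrow> real" assume f: "continuous_on UNIV f"
    then have "f \<in> borel_measurable borel" by (rule borel_measurable_continuous_onI)
    then have int: "(\<integral>y. f y \<partial>return borel b) = f b" for b
      by (simp add: integral_return)
    have "continuous_on UNIV (\<lambda>x. f (\<phi> x))"
      using f assms by (rule continuous_on_compose2) auto
    then show "((\<lambda>i. \<integral>y. f y \<partial>return borel (\<phi> i)) \<longlongrightarrow> (\<integral>y. f y \<partial>return borel (\<phi> x))) (at x)"
      unfolding int by (simp add: continuous_on_def)
  qed auto
  moreover have "atin euclidean x = at x" for x :: 'a
    by (auto simp: filter_eq_iff eventually_atin eventually_at_topological)
  ultimately show ?thesis
    unfolding CTY_def continuous_map_atin by simp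
qed

text \<open>The moment of the noise at \<open>x\<close> is the \<open>p\<close>-th power of
  \<open>norm (\<phi> x)\<close>, so properness of \<phi> bounds every sublevel set at a finite
  level. Bounded sets in Euclidean space have compact closure.\<close>

lemma CRC_transport_map_noise:
  fixes \<phi> :: "'a::euclidean_space \<Rightarrow> 'b::euclidean_space"
  assumes "p > 0" and proper: "\<And>r. bounded {x. norm (\<phi> x) \<le> r}"
  shows "CRC p (transport_map_noise \<phi>)"
  unfolding CRC_def
proof (intro allI impI)
  fix c :: ennreal assume "c < \<infinity>"
  then obtain r where r: "c = ennreal r" "0 \<le> r" by (cases c) auto
  have "{x. moment p (transport_map_noise \<phi> x) \<le> c} \<subseteq> {x. norm (\<phi> x) \<le> r powr (1 / p)}"
  proof
    fix x assume "x \<in> {x. moment p (transport_map_noise \<phi> x) \<le> c}"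
    then have "norm (\<phi> x) powr p \<le> r"
      using r by (simp add: moment_def transport_map_noise_def nn_integral_return)
    then have "(norm (\<phi> x) powr p) powr (1 / p) \<le> r powr (1 / p)"
      using \<open>p > 0\<close> by (intro powr_mono2) auto
    then show "x \<in> {x. norm (\<phi> x) \<le> r powr (1 / p)}"
      using \<open>p > 0\<close> by (simp add: powr_powr)
  qed
  then have "bounded {x. moment p (transport_map_noise \<phi> x) \<le> c}"
    using proper bounded_subset by blast
  then have "compact (closure {x. moment p (transport_map_noise \<phi> x) \<le> c})"
    by simp
  then have "totally_bounded (closure {x. moment p (transport_map_noise \<phi> x) \<le> c})"
    by (simp add: compact_eq_totally_bounded totally_bounded_metric ball_def)
  then show "totally_bounded {x. moment p (transport_map_noise \<phi> x) \<le> c}"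
    by (rule totally_bounded_subset) (rule closure_subset)
qed

section \<open>A continuous proper map with two minimal points\<close>

text \<open>Two orthogonal directions let the image move around the origin: a continuous real-valued
  map taking values \<open>r\<close> and \<open>-r\<close> with \<open>r > 0\<close> would vanish
  somewhere, so its norm would not be minimal at those points.\<close>

lemma exists_proper_map_two_minimal_points:
  fixes a b :: "'b::euclidean_space" and v :: "'a::euclidean_space"
  assumes "norm a = 1" "norm b = 1" "a \<bullet> b = 0" "norm v = 1"
  shows "\<exists>\<phi> :: 'a \<Rightarrow> 'b. continuous_on UNIV \<phi> \<and> (\<forall>r. bounded {x. norm (\<phi> x) \<le> r}) \<and>
    \<phi> 0 \<noteq> \<phi> v \<and> norm (\<phi> v) = norm (\<phi> 0) \<and>
    (\<forall>x. x \<noteq> 0 \<longrightarrow> x \<noteq> v \<longrightarrow> norm (\<phi> 0) < norm (\<phi> x))"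
proof -
  define k where "k x = norm x * norm (x - v)" for x
  \<comment> \<open>With \<open>k = 0\<close> the image would lie on the unit circle; \<open>k\<close> pushes it strictly outwards
    everywhere except at \<open>0\<close> and \<open>v\<close>, and makes the map proper.\<close>
  define \<phi> where "\<phi> x = sin (x \<bullet> v) *\<^sub>R a + (\<bar>cos (x \<bullet> v)\<bar> + k x) *\<^sub>R b" for x
  have "a \<bullet> a = 1" "b \<bullet> b = 1" "v \<bullet> v = 1" "b \<bullet> a = 0"
    using assms by (auto simp: dot_square_norm inner_commute)
  note ip = this \<open>a \<bullet> b = 0\<close>
  \<comment> \<open>The absolute value around the cosine keeps the cross term nonnegative, so adding
    \<open>k x\<close> along \<open>b\<close> never shortens the vector.\<close>
  have sq: "(norm (\<phi> x))\<^sup>2 = 1 + 2 * \<bar>cos (x \<bullet> v)\<bar> * k x + (k x)\<^sup>2" for x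
  proof -
    have "(norm (\<phi> x))\<^sup>2 = (sin (x \<bullet> v))\<^sup>2 + (\<bar>cos (x \<bullet> v)\<bar> + k x)\<^sup>2"
      unfolding power2_norm_eq_inner \<phi>_def
      by (simp add: inner_add_left inner_add_right ip power2_eq_square)
    then show ?thesis
      by (simp add: power2_sum sin_squared_eq)
  qed
  have k_nonneg: "0 \<le> k x" for x by (simp add: k_def)
  have k0: "k 0 = 0" "k v = 0" by (auto simp: k_def)
  have norm_min: "norm (\<phi> x) = 1" if "k x = 0" for x
    using that by (simp add: sq flip: power2_eq_iff_nonneg[of "norm (\<phi> x)" 1])
  have "continuous_on UNIV \<phi>"
    unfolding \<phi>_def k_def by (intro continuous_intros)
  moreover have "bounded {x. norm (\<phi> x) \<le> r}" for r
    unfolding bounded_iff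
  proof (intro exI ballI)
    fix x assume "x \<in> {x. norm (\<phi> x) \<le> r}"
    then have "norm (\<phi> x) \<le> r" by simp
    moreover have "k x \<le> norm (\<phi> x)"
      using k_nonneg by - (rule power2_le_imp_le, simp_all add: sq)
    ultimately have k: "k x \<le> r" by simp
    \<comment> \<open>Beyond this radius \<open>x\<close> is at distance at least 1 from
      \<open>v\<close>, so \<open>k x \<ge> norm x > r\<close>. Taking \<bar>r\<bar> keeps the
      radius at least 2 for negative \<open>r\<close>.\<close>
    show "norm x \<le> 2 + \<bar>r\<bar>"
    proof (rule ccontr)
      assume "\<not> norm x \<le> 2 + \<bar>r\<bar>"
      moreover have "norm x - 1 \<le> norm (x - v)"
        using norm_triangle_ineq2[of x v] assms(4) by simp
      ultimately have "2 + \<bar>r\<bar> < norm x" "1 \<le> norm (x - v)" by linarith+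
      moreover from this have "norm x * 1 \<le> k x"
        unfolding k_def by (intro mult_left_mono) auto
      ultimately show False using k by linarith
    qed
  qed
  moreover have "\<phi> 0 \<noteq> \<phi> v"
  proof -
    \<comment> \<open>The \<open>a\<close>-coordinate separates the images:
      \<open>x \<bullet> v\<close> is 0 at the origin and 1 at \<open>v\<close>, and 1 lies strictly
      between 0 and \<open>pi\<close>.\<close>
    have "sin (1::real) > 0"
      using pi_gt3 by (intro sin_gt_zero) auto
    moreover have "\<phi> 0 \<bullet> a = 0" "\<phi> v \<bullet> a = sin 1"
      by (auto simp: \<phi>_def inner_add_left ip)
    ultimately show ?thesis by auto
  qed
  moreover have "norm (\<phi> v) = norm (\<phi> 0)" using norm_min k0 by simp
  moreover have "norm (\<phi> 0) < norm (\<phi> x)" if "x \<noteq> 0" "x \<noteq> v" for x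
  proof -
    have "0 < k x" using that by (simp add: k_def)
    then have "1\<^sup>2 < (norm (\<phi> x))\<^sup>2"
      unfolding sq by (simp add: add_nonneg_pos)
    then have "1 < norm (\<phi> x)" by (rule power2_less_imp_less) simp
    then show ?thesis using norm_min[OF k0(1)] by simp
  qed
  ultimately show ?thesis by blast
qed

section \<open>The two counterexamples\<close>

theorem proposition2p6:
  fixes p :: real
  assumes "p > 1"
  shows
    "(\<exists>(\<nu> :: (real ^ 'n::finite) measure) (\<phi> :: real ^ 'm::finite \<Rightarrow> real ^ 'n).
        \<nu> \<in> finite_moment_probs p \<and> \<not> absolutely_continuous lborel \<nu> \<and>
        \<phi> \<in> borel_measurable borel \<and>
        INJ p (transport_map_noise \<phi>) \<nu> \<and>
        feasible p (transport_map_noise \<phi>) \<nu> \<and>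
        (\<exists>\<sigma> \<in> minimizers p (transport_map_noise \<phi>) \<nu>.
         \<exists>\<tau> \<in> minimizers p (transport_map_noise \<phi>) \<nu>. \<sigma> \<noteq> \<tau>)) \<and>
     (CARD('n) \<ge> 2 \<longrightarrow>
      (\<exists>(\<nu> :: (real ^ 'n) measure) (\<phi> :: real ^ 'm \<Rightarrow> real ^ 'n).
        \<nu> \<in> finite_moment_probs p \<and> \<not> absolutely_continuous lborel \<nu> \<and>
        \<phi> \<in> borel_measurable borel \<and>
        CTY (transport_map_noise \<phi>) \<and>
        CRC p (transport_map_noise \<phi>) \<and>
        INJ p (transport_map_noise \<phi>) \<nu> \<and>
        feasible p (transport_map_noise \<phi>) \<nu> \<and>
        (\<exists>\<sigma> \<in> minimizers p (transport_map_noise \<phi>) \<nu>.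
         \<exists>\<tau> \<in> minimizers p (transport_map_noise \<phi>) \<nu>. \<sigma> \<noteq> \<tau>)))"
    (is "?discontinuous \<and> (_ \<longrightarrow> ?continuous)")
proof (intro conjI impI)
  have "p > 0" using assms by simp
  define v :: "real ^ 'm" where "v = axis undefined 1"
  have v: "norm v = 1" by (simp add: v_def)
  then have "v \<noteq> 0" by auto
  show ?discontinuous
  proof -
    define u :: "real ^ 'n" where "u = axis undefined 1"
    have u: "norm u = 1" by (simp add: u_def)
    \<comment> \<open>Opposite unit vectors at \<open>0\<close> and \<open>v\<close> give the two
      minimal points; norm 2 elsewhere makes the minimum strict.\<close>
    define \<phi> where "\<phi> x = (if x = 0 then - u else if x = v then u else 2 *\<^sub>R u)" for x
    have meas: "\<phi> \<in> borel_measurable borel"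
      unfolding \<phi>_def by measurable
    have "u \<noteq> - u" 
      using u scaleR_2[of u] by (auto simp: eq_neg_iff_add_eq_0)
    then have "\<phi> 0 \<noteq> \<phi> v"
      using \<open>v \<noteq> 0\<close> by (simp add: \<phi>_def)
    moreover have "norm (\<phi> v - 0) = norm (\<phi> 0 - 0)"
      by (simp add: \<phi>_def)
    moreover have "norm (\<phi> 0 - 0) < norm (\<phi> x - 0)" if "x \<noteq> 0" "x \<noteq> v" for x
      using that u by (simp add: \<phi>_def)
    ultimately show ?thesis
      using transport_map_noise_two_nearest_points[OF \<open>p > 0\<close> meas, of 0 v 0]
        return_in_finite_moment_probs not_absolutely_continuous_return meas by blast
  qed
  assume "CARD('n) \<ge> 2"
  \<comment> \<open>Two distinct coordinate axes supply the orthonormal pair for the continuous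
    map.\<close>
  then obtain i j :: 'n where "i \<noteq> j"
    by (metis card_le_Suc0_iff_eq finite not_less_eq_eq numeral_2_eq_2)
  then have "axis i (1::real) \<bullet> axis j 1 = 0" by (simp add: inner_axis_axis)
  then obtain \<phi> :: "real ^ 'm \<Rightarrow> real ^ 'n" where cont: "continuous_on UNIV \<phi>"
    and proper: "\<And>r. bounded {x. norm (\<phi> x) \<le> r}"
    and neq: "\<phi> 0 \<noteq> \<phi> v" and eq: "norm (\<phi> v) = norm (\<phi> 0)"
    and far: "\<And>x. x \<noteq> 0 \<Longrightarrow> x \<noteq> v \<Longrightarrow> norm (\<phi> 0) < norm (\<phi> x)"
    using exists_proper_map_two_minimal_points[OF norm_axis_1 norm_axis_1 _ v] by blast
  have meas: "\<phi> \<in> borel_measurable borel"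
    using cont by (rule borel_measurable_continuous_onI)
  show ?continuous
    using transport_map_noise_two_nearest_points[OF \<open>p > 0\<close> meas neq, of 0, unfolded diff_zero, OF eq far]
      CTY_transport_map_noise[OF cont] CRC_transport_map_noise[OF \<open>p > 0\<close> proper]
      return_in_finite_moment_probs not_absolutely_continuous_return meas
    by blast
qed

end
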